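(* Let $N\ge1$, let $t_1,\dots,t_N$ be complex numbers in the open unit disk, and let $\phi:\mathcal{P}_{2N}\to\mathbb{C}$ be the linear functional defined on monomials by $$\phi(X_{i_1}\cdots X_{i_n})=t_{\epsilon(i_1)\cdots\epsilon(i_n)},\qquad i_1,\dots,i_n\in\{1,\dots,2N\}$$ (notation in the context). Then the orthonormal polynomials $\{\varphi_\sigma\}_{\sigma\in\mathbb{F}_N^+}$ of $\phi$ are $$\varphi_k=\frac{1}{d_{t_k}}(X_k-t_k),\qquad k=1,\dots,N,$$ and, for $\sigma\in\mathbb{F}_N^+$, $$\varphi_{\sigma k}=X_\sigma\varphi_k,\qquad k=1,\dots,N,$$ where $d_{t_k}=(1-|t_k|^2)^{1/2}$.
   Context: $\mathcal{P}_{2N}$ is the algebra of complex polynomials in noncommuting variables $X_1,\dots,X_{2N}$, with the conjugate-linear anti-multiplicative involution $^+$ determined by $X_k^+=X_{N+k}$ for $1\le k\le N$ and $X_l^+=X_{l-N}$ for $N<l\le 2N$. $\mathbb{F}_N^+$ is the unital free semigroup on generators $1,\dots,N$ with unit $\emptyset$ (the empty word), ordered by $\preceq$: shorter words come first and words of equal length are ordered lexicographically. For $\sigma=i_1\cdots i_k\in\mathbb{F}_N^+$, $X_\sigma=X_{i_1}\cdots X_{i_k}$ (and $X_\emptyset=1$). $\mathcal{P}_N\subset\mathcal{P}_{2N}$ is the subalgebra generated by $X_1,\dots,X_N$. $\mathbb{F}_N$ is the free group on generators $1,\dots,N$. For a reduced word $\sigma=i_1^{k_1}\cdots i_n^{k_n}\in\mathbb{F}_N$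 ($i_j\ne i_{j+1}$, $k_j\in\mathbb{Z}\setminus\{0\}$) set $t_\sigma=t_{i_1}^{[k_1]}\cdots t_{i_n}^{[k_n]}$, where $t^{[k]}=t^k$ for $k\ge0$ and $t^{[k]}=\overline{t}^{\,-k}$ for $k<0$; $t_{\emptyset}=1$. For $1\le i\le 2N$, $\epsilon(i)\in\mathbb{F}_N$ is $i$ if $1\le i\le N$ and $(i-N)^{-1}$ if $N<i\le 2N$; the product $\epsilon(i_1)\cdots\epsilon(i_n)$ is taken in $\mathbb{F}_N$ (and then written as a reduced word). The functional $\phi$ is strictly q-positive, i.e. $\phi(P^+P)>0$ for all nonzero $P\in\mathcal{P}_N$. Its orthonormal polynomials are obtained by applying Gram–Schmidt to $\{X_\sigma\}_{\sigma\in\mathbb{F}_N^+}$ in the order $\preceq$; that is, they are the unique elements $\varphi_\alpha=\sum_{\beta\preceq\alpha}a_{\alpha,\beta}X_\beta$ with $a_{\alpha,\alpha}>0$ such that $\phi(\varphi_\beta^+\varphi_\alpha)=\delta_{\alpha,\beta}$ for all $\alpha,\beta\in\mathbb{F}_N^+$. *)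

theory Defs
  imports
    "HOL-Analysis.Analysis"
    "HOL-Algebra.Group"
    "HOL-Library.Poly_Mapping"
    "HOL-Library.Complex_Order"
begin

text \<open>Lists under concatenation are the free monoid, written additively because
  \<^typ>\<open>'a \<Rightarrow>\<^sub>0 'b\<close> is a (convolution) ring only over additive monoids.\<close>

instantiation list :: (type) monoid_add
begin
definition zero_list :: "'a list" where "zero_list = []"
definition plus_list :: "'a list \<Rightarrow> 'a list \<Rightarrow> 'a list" where "plus_list u v = u @ v"
instance by standard (simp_all add: zero_list_def plus_list_def)
end


subsection \<open>Noncommutative polynomials\<close>

text \<open>Polynomials in variables \<open>X\<^sub>i\<close> indexed by all naturals; \<open>polys n\<close> is the subalgebra
  in \<open>X\<^sub>1, \<dots>, X\<^sub>n\<close>, so that both \<open>\<P>\<^sub>N\<close> and \<open>\<P>\<^sub>2\<^sub>N\<close> are instances of it.\<close>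

type_synonym ncpoly = "nat list \<Rightarrow>\<^sub>0 complex"

definition const :: "complex \<Rightarrow> ncpoly" where
  "const c = Poly_Mapping.single [] c"

definition var :: "nat \<Rightarrow> ncpoly" where
  "var i = Poly_Mapping.single [i] 1"

definition mono_word :: "nat list \<Rightarrow> ncpoly" where
  "mono_word w = prod_list (map var w)"

definition words :: "nat \<Rightarrow> nat list set" where
  "words n = lists {1..n}"

definition polys :: "nat \<Rightarrow> ncpoly set" where
  "polys n = {P. Poly_Mapping.keys P \<subseteq> words n}"

definition adj_index :: "nat \<Rightarrow> nat \<Rightarrow> nat" where
  "adj_index N i = (if i \<le> N then N + i else i - N)"

text \<open>The involution \<open>P\<^sup>+\<close> of \<open>\<P>\<^sub>2\<^sub>N\<close>, written out on the monomial basis.\<close>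

definition adj :: "nat \<Rightarrow> ncpoly \<Rightarrow> ncpoly" where
  "adj N P = (\<Sum>w\<in>Poly_Mapping.keys P.
     const (cnj (Poly_Mapping.lookup P w)) * mono_word (rev (map (adj_index N) w)))"

definition linear_functional_on :: "ncpoly set \<Rightarrow> (ncpoly \<Rightarrow> complex) \<Rightarrow> bool" where
  "linear_functional_on V \<phi> \<longleftrightarrow>
     (\<forall>P\<in>V. \<forall>Q\<in>V. \<phi> (P + Q) = \<phi> P + \<phi> Q) \<and>
     (\<forall>c. \<forall>P\<in>V. \<phi> (const c * P) = c * \<phi> P)"


subsection \<open>Orthonormal polynomials\<close>

text \<open>Here and below \<open>0 < z\<close> for complex \<open>z\<close> means that \<open>z\<close> is real and positive.\<close>

definition strictly_q_positive :: "nat \<Rightarrow> (ncpoly \<Rightarrow> complex) \<Rightarrow> bool" where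
  "strictly_q_positive N \<phi> \<longleftrightarrow> (\<forall>P\<in>polys N. P \<noteq> 0 \<longrightarrow> 0 < \<phi> (adj N P * P))"

text \<open>\<^term>\<open>lenlex\<close> compares the lengths first and is lexicographic on words of equal length.\<close>

definition word_le :: "nat list \<Rightarrow> nat list \<Rightarrow> bool" (infix \<open>\<preceq>\<close> 50) where
  "u \<preceq> v \<longleftrightarrow> u = v \<or> (u, v) \<in> lenlex less_than"

text \<open>Only the values of \<open>p\<close> on \<^term>\<open>words N\<close> matter.\<close>

definition orthonormal_polynomials ::
    "nat \<Rightarrow> (ncpoly \<Rightarrow> complex) \<Rightarrow> (nat list \<Rightarrow> ncpoly) \<Rightarrow> bool" where
  "orthonormal_polynomials N \<phi> p \<longleftrightarrow>
     (\<forall>\<alpha>\<in>words N. \<exists>a. 0 < a \<alpha> \<and>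
        p \<alpha> = (\<Sum>\<beta>\<in>{\<beta>\<in>words N. \<beta> \<preceq> \<alpha>}. const (a \<beta>) * mono_word \<beta>)) \<and>
     (\<forall>\<alpha>\<in>words N. \<forall>\<beta>\<in>words N.
        \<phi> (adj N (p \<beta>) * p \<alpha>) = (if \<alpha> = \<beta> then 1 else 0))"

lemma finite_word_le: "finite {\<beta>\<in>words N. \<beta> \<preceq> \<alpha>}"
proof (rule finite_subset)
  show "{\<beta>\<in>words N. \<beta> \<preceq> \<alpha>} \<subseteq> {\<beta>. set \<beta> \<subseteq> {1..N} \<and> length \<beta> \<le> length \<alpha>}"
    by (auto simp: words_def word_le_def lenlex_conv)
  show "finite {\<beta>. set \<beta> \<subseteq> {1..N} \<and> length \<beta> \<le> length \<alpha>}"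
    by (rule finite_lists_length_le) simp
qed


subsection \<open>The free group\<close>

text \<open>Its elements are the reduced words: the list \<open>[(i\<^sub>1, k\<^sub>1), \<dots>, (i\<^sub>n, k\<^sub>n)]\<close> stands
  for \<open>i\<^sub>1\<^bsup>k\<^sub>1\<^esup> \<cdots> i\<^sub>n\<^bsup>k\<^sub>n\<^esup>\<close>.\<close>

definition reduced_words :: "nat \<Rightarrow> (nat \<times> int) list set" where
  "reduced_words N = {w. (\<forall>(i, k)\<in>set w. i \<in> {1..N} \<and> k \<noteq> 0) \<and> distinct_adj (map fst w)}"

text \<open>The reduced form of the product of \<open>i\<^bsup>k\<^esup>\<close> with a reduced word.\<close>

fun syl_mult :: "nat \<times> int \<Rightarrow> (nat \<times> int) list \<Rightarrow> (nat \<times> int) list" where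
  "syl_mult (i, k) [] = (if k = 0 then [] else [(i, k)])"
| "syl_mult (i, k) ((j, l) # w) =
     (if k = 0 then (j, l) # w
      else if i = j then (if k + l = 0 then w else (i, k + l) # w)
      else (i, k) # (j, l) # w)"

definition free_group :: "nat \<Rightarrow> (nat \<times> int) list monoid" where
  "free_group N = \<lparr>carrier = reduced_words N, mult = (\<lambda>u v. foldr syl_mult u v), one = []\<rparr>"

lemma Nil_reduced: "[] \<in> reduced_words N"
  by (simp add: reduced_words_def)

lemma Cons_reduced_iff: "(i, k) # w \<in> reduced_words N \<longleftrightarrow>
    i \<in> {1..N} \<and> k \<noteq> 0 \<and> (w \<noteq> [] \<longrightarrow> i \<noteq> fst (hd w)) \<and> w \<in> reduced_words N"
  by (cases w) (auto simp: reduced_words_def)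

lemma syl_mult_reduced: "w \<in> reduced_words N \<Longrightarrow> i \<in> {1..N} \<Longrightarrow> syl_mult (i, k) w \<in> reduced_words N"
  by (cases w) (auto simp: Cons_reduced_iff Nil_reduced)

lemma syl_mult_zero: "syl_mult (i, 0) w = w"
  by (cases w) auto

lemma syl_mult_add:
  "w \<in> reduced_words N \<Longrightarrow> syl_mult (i, k) (syl_mult (i, l) w) = syl_mult (i, k + l) w"
proof (cases w)
  case (Cons p v)
  assume "w \<in> reduced_words N"
  then show ?thesis
    using Cons by (cases p; cases v) (auto simp: Cons_reduced_iff)
qed auto

lemma foldr_syl_mult_reduced:
  "w \<in> reduced_words N \<Longrightarrow> fst ` set u \<subseteq> {1..N} \<Longrightarrow> foldr syl_mult u w \<in> reduced_words N"
  by (induction u) (auto simp: syl_mult_reduced simp del: atLeastAtMost_iff)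

lemma fst_reduced: "u \<in> reduced_words N \<Longrightarrow> fst ` set u \<subseteq> {1..N}"
  by (auto simp: reduced_words_def)

lemma foldr_syl_mult_assoc:
  assumes w: "w \<in> reduced_words N"
  shows "fst ` set u \<subseteq> {1..N} \<Longrightarrow> v \<in> reduced_words N \<Longrightarrow>
    foldr syl_mult (foldr syl_mult u v) w = foldr syl_mult u (foldr syl_mult v w)"
proof (induction u)
  case (Cons p u)
  have *: "foldr syl_mult (syl_mult p x) w = syl_mult p (foldr syl_mult x w)"
    if x: "x \<in> reduced_words N" for x
  proof (cases x)
    case Nil
    then show ?thesis by (cases p) (auto simp: syl_mult_zero)
  next
    case (Cons q y)
    then have "fst ` set y \<subseteq> {1..N}"
      using fst_reduced[OF x] by auto
    then have y: "foldr syl_mult y w \<in> reduced_words N"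
      by (rule foldr_syl_mult_reduced[OF w])
    obtain i k j l where pq: "p = (i, k)" "q = (j, l)"
      by (metis prod.exhaust)
    show ?thesis
      using Cons pq syl_mult_add[OF y, of j k l]
      by (auto simp: syl_mult_zero)
  qed
  have "foldr syl_mult u v \<in> reduced_words N"
    using Cons.prems by (intro foldr_syl_mult_reduced) auto
  then show ?case
    using Cons * by simp
qed simp

lemma foldr_syl_mult_Nil: "u \<in> reduced_words N \<Longrightarrow> foldr syl_mult u [] = u"
proof (induction u)
  case (Cons p u)
  then show ?case
    by (cases p; cases u) (auto simp: Cons_reduced_iff)
qed simp

lemma group_free_group: "group (free_group N)"
proof (rule groupI)
  fix u assume u: "u \<in> carrier (free_group N)"
  let ?inv = "rev (map (\<lambda>(i, k). (i, - k)) u)"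
  have cancel: "foldr syl_mult (rev (map (\<lambda>(i, k). (i, - k)) x)) (foldr syl_mult x w) = w"
    if "fst ` set x \<subseteq> {1..N}" "w \<in> reduced_words N" for x w
    using that
  proof (induction x)
    case (Cons p x)
    have "foldr syl_mult x w \<in> reduced_words N"
      using Cons.prems by (intro foldr_syl_mult_reduced) auto
    then show ?case
      using Cons by (cases p) (auto simp: syl_mult_add syl_mult_zero)
  qed simp
  have "u \<in> reduced_words N"
    using u by (simp add: free_group_def)
  then have "?inv \<in> reduced_words N" "foldr syl_mult ?inv (foldr syl_mult u []) = []"
    using cancel[OF fst_reduced Nil_reduced, of u]
    by (auto simp: reduced_words_def rev_map[symmetric] o_def case_prod_unfold)
  then show "\<exists>v\<in>carrier (free_group N). v \<otimes>\<^bsub>free_group N\<^esub> u = \<one>\<^bsub>free_group N\<^esub>"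
    using \<open>u \<in> reduced_words N\<close>
    by (intro bexI[of _ ?inv]) (simp_all add: free_group_def foldr_syl_mult_Nil)
qed (auto simp: free_group_def Nil_reduced
       intro: foldr_syl_mult_reduced fst_reduced[THEN subsetD] foldr_syl_mult_assoc fst_reduced)

definition eps :: "nat \<Rightarrow> nat \<Rightarrow> (nat \<times> int) list" where
  "eps N i = (if i \<le> N then [(i, 1)] else [(i - N, - 1)])"

lemma eps_inverse:
  "i \<in> {N<..2*N} \<Longrightarrow> eps N i = inv\<^bsub>free_group N\<^esub> (eps N (i - N))"
  by (rule group.inv_equality[OF group_free_group, symmetric])
     (auto simp: eps_def free_group_def reduced_words_def)

definition eps_word :: "nat \<Rightarrow> nat list \<Rightarrow> (nat \<times> int) list" where
  "eps_word N w = foldr (\<lambda>i g. eps N i \<otimes>\<^bsub>free_group N\<^esub> g) w \<one>\<^bsub>free_group N\<^esub>"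

definition bracket_power :: "complex \<Rightarrow> int \<Rightarrow> complex" where
  "bracket_power z k = (if 0 \<le> k then z ^ nat k else cnj z ^ nat (- k))"

definition t_word :: "(nat \<Rightarrow> complex) \<Rightarrow> (nat \<times> int) list \<Rightarrow> complex" where
  "t_word t \<sigma> = prod_list (map (\<lambda>(i, k). bracket_power (t i) k) \<sigma>)"

definition defect :: "complex \<Rightarrow> real" where
  "defect z = sqrt (1 - (cmod z)\<^sup>2)"

end

theory Submission
  imports Defs "HOL-Library.Sublist"
begin

text \<open>The value \<open>\<phi>(X\<^sub>\<beta>\<^sup>+ X\<^sub>\<alpha>) = t\<^bsub>\<beta>\<inverse>\<alpha>\<^esub>\<close> is computed by stripping the longest common
  prefix of \<open>\<alpha>\<close> and \<open>\<beta>\<close>; no further cancellation occurs, so it is the product of the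
  \<open>t\<close>'s of what is left of \<open>\<alpha>\<close> and the conjugates of those of what is left of \<open>\<beta>\<close>.
  Hence appending a letter \<open>k\<close> to \<open>\<alpha>\<close> multiplies it by \<open>t\<^sub>k\<close> unless \<open>\<alpha>k\<close> is a prefix
  of \<open>\<beta>\<close>, that is, \<open>X\<^bsub>\<alpha>k\<^esub> - t\<^sub>k X\<^sub>\<alpha>\<close> is orthogonal to \<open>X\<^sub>\<beta>\<close> unless \<open>\<alpha>k\<close> is a
  prefix of \<open>\<beta>\<close>. Of two distinct words, one is not a prefix of the other, which gives
  orthogonality of the claimed polynomials. They span \<open>\<P>\<^sub>N\<close>, so positivity follows
  by expanding in them, and the uniqueness is that of Gram--Schmidt.\<close>


subsection \<open>Monomials and the involution\<close>

lemma mono_word_single: "mono_word w = Poly_Mapping.single w 1"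
  by (induction w) (simp_all add: mono_word_def var_def mult_single plus_list_def
      zero_list_def flip: single_one)

lemma mono_word_append: "mono_word (u @ v) = mono_word u * mono_word v"
  by (simp add: mono_word_def)

lemma const_mult_single: "const c * Poly_Mapping.single w d = Poly_Mapping.single w (c * d)"
  by (simp add: const_def mult_single plus_list_def)

lemma single_mult_const: "Poly_Mapping.single w d * const c = Poly_Mapping.single w (c * d)"
  by (simp add: const_def mult_single plus_list_def mult.commute)

lemma poly_eq_sum_single:
  assumes "finite A" "Poly_Mapping.keys P \<subseteq> A"
  shows "P = (\<Sum>w\<in>A. Poly_Mapping.single w (Poly_Mapping.lookup P w))"
  using assms
  by (intro poly_mapping_eqI) (auto simp: lookup_sum lookup_single when_def in_keys_iff)

lemma const_mult_eq_sum:
  "const c * P = (\<Sum>w\<in>Poly_Mapping.keys P. Poly_Mapping.single w (c * Poly_Mapping.lookup P w))"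
  by (subst (1) poly_eq_sum_single[OF finite_keys subset_refl, of P])
    (simp add: sum_distrib_left const_mult_single)

text \<open>Scalars sit on the empty word, the unit of concatenation, so multiplication on either
  side scales each coefficient.\<close>

lemma const_commute: "const c * P = P * const c"
  unfolding const_mult_eq_sum
  by (subst (3) poly_eq_sum_single[OF finite_keys subset_refl, of P])
    (simp add: sum_distrib_right single_mult_const)

lemma const_left_commute: "P * (const c * Q) = const c * (P * Q)"
  by (metis const_commute mult.assoc)

lemma lookup_const_mult: "Poly_Mapping.lookup (const c * P) w = c * Poly_Mapping.lookup P w"
  by (auto simp: const_mult_eq_sum lookup_sum lookup_single when_def in_keys_iff)

lemma const_mult: "const (c * d) = const c * const d"
  by (simp add: const_def mult_single plus_list_def)

lemma const_add: "const (c + d) = const c + const d"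
  by (simp add: const_def single_add)

lemma const_zero [simp]: "const 0 = 0"
  by (simp add: const_def)

lemma const_one [simp]: "const 1 = 1"
  by (simp add: const_def flip: single_one zero_list_def)

lemma const_uminus: "const (- c) = - const c"
  by (simp add: const_def single_uminus)

lemma const_diff: "const (c - d) = const c - const d"
  by (simp add: const_def single_diff)

lemma poly_eq_sum_mono:
  assumes "finite A" "Poly_Mapping.keys P \<subseteq> A"
  shows "P = (\<Sum>w\<in>A. const (Poly_Mapping.lookup P w) * mono_word w)"
  using poly_eq_sum_single[OF assms] by (simp add: mono_word_single const_mult_single)

lemma mono_word_in_polys: "w \<in> words n \<Longrightarrow> mono_word w \<in> polys n"
  by (simp add: mono_word_single polys_def)

lemma polys_add: "P \<in> polys n \<Longrightarrow> Q \<in> polys n \<Longrightarrow> P + Q \<in> polys n"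
  unfolding polys_def using Poly_Mapping.keys_add[of P Q] by blast

lemma polys_zero: "0 \<in> polys n"
  by (simp add: polys_def)

lemma polys_const_mult: "P \<in> polys n \<Longrightarrow> const c * P \<in> polys n"
  by (auto simp: polys_def in_keys_iff lookup_const_mult subset_iff)

lemma polys_uminus: "P \<in> polys n \<Longrightarrow> - P \<in> polys n"
  by (simp add: polys_def)

lemma polys_diff: "P \<in> polys n \<Longrightarrow> Q \<in> polys n \<Longrightarrow> P - Q \<in> polys n"
  using polys_add[of P n "- Q"] by (simp add: polys_uminus)

lemma polys_sum: "(\<And>i. i \<in> A \<Longrightarrow> f i \<in> polys n) \<Longrightarrow> sum f A \<in> polys n"
  by (induction A rule: infinite_finite_induct) (auto intro: polys_add polys_zero)

lemma polys_mult: "P \<in> polys n \<Longrightarrow> Q \<in> polys n \<Longrightarrow> P * Q \<in> polys n"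
  using Poly_Mapping.keys_mult[of P Q]
  by (fastforce simp: polys_def words_def plus_list_def)

lemma words_mono: "m \<le> n \<Longrightarrow> words m \<subseteq> words n"
  unfolding words_def by (intro lists_mono) auto

lemma polys_mono: "m \<le> n \<Longrightarrow> polys m \<subseteq> polys n"
  unfolding polys_def using words_mono by blast

lemma words_Nil: "[] \<in> words n"
  by (simp add: words_def)

lemma words_append: "u @ v \<in> words n \<longleftrightarrow> u \<in> words n \<and> v \<in> words n"
  by (auto simp: words_def)

lemma words_singleton: "[k] \<in> words n \<longleftrightarrow> k \<in> {1..n}"
  by (simp add: words_def)

section \<open>The involution on words and on polynomials\<close>

definition adj_word :: "nat \<Rightarrow> nat list \<Rightarrow> nat list" where
  "adj_word N w = rev (map (adj_index N) w)"

lemma adj_word_in_words: "w \<in> words N \<Longrightarrow> adj_word N w \<in> words (2 * N)"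
  by (fastforce simp: words_def adj_word_def adj_index_def lists_eq_set)

text \<open>Coefficients vanish off the support, so any finite superset may index the sum. With a
  common index set, conjugate-linearity of \<open>adj\<close> becomes termwise.\<close>

lemma adj_eq_sum:
  assumes "finite A" "Poly_Mapping.keys P \<subseteq> A"
  shows "adj N P = (\<Sum>w\<in>A. const (cnj (Poly_Mapping.lookup P w)) * mono_word (adj_word N w))"
  unfolding adj_def adj_word_def
  using assms by (intro sum.mono_neutral_left) (auto simp: in_keys_iff)

lemma adj_add: "adj N (P + Q) = adj N P + adj N Q"
proof -
  let ?A = "Poly_Mapping.keys P \<union> Poly_Mapping.keys Q"
  have "finite ?A" "Poly_Mapping.keys (P + Q) \<subseteq> ?A"
    using Poly_Mapping.keys_add[of P Q] by auto
  then show ?thesis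
    by (simp add: adj_eq_sum[of ?A] lookup_add const_add ring_distribs sum.distrib)
qed

lemma adj_const_mult: "adj N (const c * P) = const (cnj c) * adj N P"
proof -
  have "Poly_Mapping.keys (const c * P) \<subseteq> Poly_Mapping.keys P"
    by (auto simp: in_keys_iff lookup_const_mult)
  then show ?thesis
    by (simp add: adj_eq_sum[of "Poly_Mapping.keys P"] lookup_const_mult const_mult
        sum_distrib_left mult.assoc)
qed

lemma adj_mono_word: "adj N (mono_word w) = mono_word (adj_word N w)"
  by (simp add: adj_eq_sum[of "{w}"] mono_word_single)

lemma adj_in_polys: "P \<in> polys N \<Longrightarrow> adj N P \<in> polys (2 * N)"
  unfolding adj_eq_sum[OF finite_keys subset_refl]
  by (intro polys_sum polys_const_mult mono_word_in_polys adj_word_in_words)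
    (auto simp: polys_def)


subsection \<open>The moments\<close>

definition t_prod :: "(nat \<Rightarrow> complex) \<Rightarrow> nat list \<Rightarrow> complex" where
  "t_prod t w = prod_list (map t w)"

text \<open>Closed form of t at u^{-1} v: equal first letters cancel, and the first disagreement
  ends all cancellation. The letters of \<open>u\<close> occur inverted, hence the
  conjugate.\<close>

fun kernel :: "(nat \<Rightarrow> complex) \<Rightarrow> nat list \<Rightarrow> nat list \<Rightarrow> complex" where
  "kernel t [] v = t_prod t v"
| "kernel t u [] = cnj (t_prod t u)"
| "kernel t (i # u) (j # v) =
     (if i = j then kernel t u v else cnj (t_prod t (i # u)) * t_prod t (j # v))"

text \<open>Pattern completion restricts the second equation of \<open>kernel\<close> to nonempty
  \<open>u\<close>; for empty \<open>u\<close> both sides are 1.\<close>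

lemma kernel_Nil2 [simp]: "kernel t u [] = cnj (t_prod t u)"
  by (cases u) (simp_all add: t_prod_def)

text \<open>Hermitian symmetry, which carries the rules for a letter appended to the second word
  over to the first.\<close>

lemma kernel_cnj: "kernel t u v = cnj (kernel t v u)"
proof (induction t u v rule: kernel.induct)
  case (3 t i u j v)
  show ?case
  proof (cases "i = j")
    case True
    then show ?thesis using 3 by simp
  next
    case False
    then show ?thesis by simp
  qed
qed simp_all

lemma kernel_refl: "kernel t u u = 1"
  by (induction u) (auto simp: t_prod_def)

text \<open>The appended letter could cancel only if all of \<open>v\<close> cancels and
  \<open>k\<close> is the next letter of \<open>u\<close>. Otherwise it survives as one more
  factor.\<close>

lemma kernel_snoc: "\<not> prefix (v @ [k]) u \<Longrightarrow> kernel t u (v @ [k]) = kernel t u v * t k"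
by (induction t u v rule: kernel.induct) (auto simp: t_prod_def)

lemma kernel_snoc_self: "kernel t u (u @ [k]) = t k"
  by (induction u) (auto simp: t_prod_def)

section \<open>Evaluation of words in the free group\<close>

lemma eps_word_Nil: "eps_word N [] = []"
  by (simp add: eps_word_def free_group_def)

lemma eps_word_Cons:
  "eps_word N (i # w) = syl_mult (if i \<le> N then (i, 1) else (i - N, - 1)) (eps_word N w)"
  by (simp add: eps_word_def free_group_def eps_def)

lemma eps_word_reduced: "w \<in> words (2 * N) \<Longrightarrow> eps_word N w \<in> reduced_words N"
  by (induction w)
    (auto simp: eps_word_Nil eps_word_Cons Nil_reduced words_def intro!: syl_mult_reduced)

text \<open>Prepending \<open>u\<close> acts on the group element of the rest alone, so a
  cancellation may take place in the middle of a word.\<close>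

lemma eps_word_append_cong:
  "eps_word N v = eps_word N v' \<Longrightarrow> eps_word N (u @ v) = eps_word N (u @ v')"
  by (induction u) (simp_all add: eps_word_Cons)

text \<open>The exponents -1 and 1 add up to 0; \<open>syl_mult_add\<close> applies because the word
  of \<open>v\<close> is reduced.\<close>

lemma eps_word_cancel:
  assumes "i \<in> {1..N}" "v \<in> words (2 * N)"
  shows "eps_word N (adj_index N i # i # v) = eps_word N v"
  using assms syl_mult_add[OF eps_word_reduced[OF assms(2)], of i "- 1" 1]
  by (simp add: eps_word_Cons adj_index_def syl_mult_zero)

lemma t_word_Cons: "t_word t ((i, k) # w) = bracket_power (t i) k * t_word t w"
  by (simp add: t_word_def)

text \<open>Powers t^{[k]} multiply only when the exponents have the same sign. The assumption rules
  out merging with a nonpositive power of \<open>i\<close>.\<close>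

lemma t_word_syl_mult_pos:
  assumes "w = [] \<or> fst (hd w) \<noteq> i \<or> 0 < snd (hd w)"
  shows "t_word t (syl_mult (i, 1) w) = t i * t_word t w"
  using assms
  by (cases w) (auto simp: t_word_Cons bracket_power_def nat_add_distrib t_word_def)

lemma t_word_syl_mult_neg:
  assumes "w = [] \<or> fst (hd w) \<noteq> i \<or> snd (hd w) < 0"
  shows "t_word t (syl_mult (i, - 1) w) = cnj (t i) * t_word t w"
proof (cases w)
  case (Cons p v)
  obtain j l where "p = (j, l)" by fastforce
  moreover have "nat (1 - l) = Suc (nat (- l))" if "l < 0" using that by simp
  ultimately show ?thesis
    using assms Cons by (auto simp: t_word_Cons bracket_power_def t_word_def)
qed (auto simp: t_word_def bracket_power_def)

text \<open>The leading syllable is tracked for two reasons: its positive exponent drives the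
  induction through \<open>t_word_syl_mult_pos\<close>, and its letter later shows that the inverse
  of a different letter cancels nothing.\<close>

lemma eps_word_positive:
  assumes "v \<in> words N"
  shows "t_word t (eps_word N v) = t_prod t v"
    and "v \<noteq> [] \<Longrightarrow> eps_word N v \<noteq> [] \<and> fst (hd (eps_word N v)) = hd v \<and> 0 < snd (hd (eps_word N v))"
proof -
  have *: "t_word t (eps_word N v) = t_prod t v \<and>
    (v \<noteq> [] \<longrightarrow> eps_word N v \<noteq> [] \<and> fst (hd (eps_word N v)) = hd v \<and> 0 < snd (hd (eps_word N v)))"
    using assms
  proof (induction v)
    case (Cons i v)
    then have i: "i \<le> N" and IH: "t_word t (eps_word N v) = t_prod t v"
      and h: "eps_word N v = [] \<or> 0 < snd (hd (eps_word N v))"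
      by (auto simp: words_def eps_word_Nil)
    have "syl_mult (i, 1) w \<noteq> [] \<and> fst (hd (syl_mult (i, 1) w)) = i \<and> 0 < snd (hd (syl_mult (i, 1) w))"
      if "w = [] \<or> 0 < snd (hd w)" for w
      using that by (cases w) (auto split: if_splits)
    with i IH h show ?case
      by (simp add: eps_word_Cons t_word_syl_mult_pos t_prod_def)
  qed (simp add: eps_word_Nil t_word_def t_prod_def)
  show "t_word t (eps_word N v) = t_prod t v"
    and "v \<noteq> [] \<Longrightarrow> eps_word N v \<noteq> [] \<and> fst (hd (eps_word N v)) = hd v \<and> 0 < snd (hd (eps_word N v))"
    using * by auto
qed

text \<open>At the junction of u^{-1} and v stand the inverse of the first letter of
  \<open>u\<close> and the first letter of \<open>v\<close>. These differ, so nothing cancels and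
  \<open>t_word\<close> is multiplicative.\<close>

lemma eps_word_adj_append:
  assumes "u \<in> words N" "v \<in> words N" "u = [] \<or> v = [] \<or> hd u \<noteq> hd v"
  shows "t_word t (eps_word N (adj_word N u @ v)) = cnj (t_prod t u) * t_prod t v"
proof -
  let ?e = "\<lambda>u. eps_word N (adj_word N u @ v)"
  have "t_word t (?e u) = cnj (t_prod t u) * t_prod t v \<and>
    (u \<noteq> [] \<longrightarrow> ?e u \<noteq> [] \<and> snd (hd (?e u)) < 0)"
    using assms
  \<comment> \<open>\<open>adj_word\<close> reverses, so appending a letter to \<open>u\<close>
    prepends its inverse to the product. The negative leading exponent is the invariant that keeps
    this free of cancellation.\<close>
  proof (induction u rule: rev_induct)
    case Nil
    then show ?case by (simp add: adj_word_def eps_word_positive t_prod_def)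
  next
    case (snoc i u)
    have i: "i \<in> {1..N}" and u: "u \<in> words N"
      using snoc.prems by (simp_all add: words_append words_singleton)
    have e: "?e (u @ [i]) = syl_mult (i, - 1) (?e u)"
      using i by (simp add: adj_word_def eps_word_Cons adj_index_def)
    have "u = [] \<or> v = [] \<or> hd u \<noteq> hd v"
      using snoc.prems by (cases u) auto
    then have IH: "t_word t (?e u) = cnj (t_prod t u) * t_prod t v"
        "u \<noteq> [] \<Longrightarrow> ?e u \<noteq> [] \<and> snd (hd (?e u)) < 0"
      using snoc.IH u snoc.prems(2) by auto
    \<comment> \<open>The new inverse letter meets an inverse letter coming from \<open>u\<close>
      or, if \<open>u\<close> is empty, the first letter of \<open>v\<close>, which is not
      \<open>i\<close>.\<close>
    have h: "?e u = [] \<or> fst (hd (?e u)) \<noteq> i \<or> snd (hd (?e u)) < 0"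
    proof (cases "u = []")
      case True
      then show ?thesis
        using snoc.prems eps_word_positive(2)[OF snoc.prems(2)]
        by (cases "v = []") (auto simp: adj_word_def eps_word_Nil)
    qed (use IH(2) in auto)
    have "syl_mult (i, - 1) w \<noteq> [] \<and> snd (hd (syl_mult (i, - 1) w)) < 0"
      if "w = [] \<or> fst (hd w) \<noteq> i \<or> snd (hd w) < 0" for w
      using that by (cases w) (auto split: if_splits)
    with h IH(1) show ?case
      by (simp add: e t_word_syl_mult_neg t_prod_def)
  qed
  then show ?thesis ..
qed

text \<open>Reversal puts the first letter of \<open>u\<close> next to \<open>v\<close>. A common
  first letter thus cancels in the middle, as in the recursion of \<open>kernel\<close>; distinct
  ones are the case without cancellation.\<close>

lemma t_word_adj_append:
  "u \<in> words N \<Longrightarrow> v \<in> words N \<Longrightarrow>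
    t_word t (eps_word N (adj_word N u @ v)) = kernel t u v"
proof (induction t u v rule: kernel.induct)
  case (1 t v)
  then show ?case by (simp add: adj_word_def eps_word_positive)
next
  case (2 t i u)
  then show ?case using eps_word_adj_append[of "i # u" N "[]" t]
    by (simp add: t_prod_def words_Nil)
next
  case (3 t i u j v)
  show ?case
  proof (cases "i = j")
    case True
    have *: "i \<in> {1..N}" "u \<in> words N" "v \<in> words N" "v \<in> words (2 * N)"
      using 3 True words_mono[of N "2 * N"] by (auto simp: words_def)
    have "eps_word N (adj_word N (i # u) @ j # v) = eps_word N (adj_word N u @ adj_index N i # i # v)"
      using True by (simp add: adj_word_def)
    also have "\<dots> = eps_word N (adj_word N u @ v)"
      by (intro eps_word_append_cong eps_word_cancel *)
    finally show ?thesis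
      using 3(1)[OF True] * True by simp
  next
    case False
    then show ?thesis
      using eps_word_adj_append[OF 3(2,3)] by simp
  qed
qed


subsection \<open>The orthonormal basis\<close>

text \<open>A combination of monomials, instead of the product \<open>X\<^sub>\<sigma> \<phi>\<^sub>k\<close>, so that the Gram
  matrix can be read off from the moments.\<close>

definition basis_poly :: "(nat \<Rightarrow> complex) \<Rightarrow> nat list \<Rightarrow> ncpoly" where
  "basis_poly t w = (if w = [] then 1 else
     const (complex_of_real (1 / defect (t (last w)))) *
       (mono_word w - const (t (last w)) * mono_word (butlast w)))"

lemma basis_poly_Nil [simp]: "basis_poly t [] = 1"
  by (simp add: basis_poly_def)

lemma basis_poly_snoc: "basis_poly t (w @ [k]) =
    const (complex_of_real (1 / defect (t k))) * (mono_word (w @ [k]) - const (t k) * mono_word w)"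
  by (simp add: basis_poly_def)

lemma mono_word_Nil [simp]: "mono_word [] = 1"
  by (simp add: mono_word_def)

lemma mono_word_singleton: "mono_word [k] = var k"
  by (simp add: mono_word_def)

lemma basis_poly_singleton:
  "basis_poly t [k] = const (complex_of_real (1 / defect (t k))) * (var k - const (t k))"
  using basis_poly_snoc[of t "[]" k] by (simp add: mono_word_singleton)

text \<open>Since scalars are central, the explicit combination is the product that the theorem
  speaks of.\<close>

lemma basis_poly_snoc_eq_mult: "basis_poly t (w @ [k]) = mono_word w * basis_poly t [k]"
proof -
  have "mono_word w * basis_poly t [k] = const (complex_of_real (1 / defect (t k))) *
      (mono_word w * var k - mono_word w * const (t k))"
    by (simp only: basis_poly_singleton const_left_commute right_diff_distrib)
  also have "\<dots> = basis_poly t (w @ [k])"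
    by (simp only: basis_poly_snoc mono_word_append mono_word_singleton const_commute[of "t k"])
  finally show ?thesis by simp
qed

lemma basis_poly_in_polys: "w \<in> words N \<Longrightarrow> basis_poly t w \<in> polys N"
proof (cases w rule: rev_cases)
  case Nil
  then show ?thesis using mono_word_in_polys[OF words_Nil] by simp
next
  case (snoc v k)
  assume "w \<in> words N"
  with snoc show ?thesis
    by (simp add: basis_poly_snoc words_append polys_const_mult polys_diff mono_word_in_polys)
qed

lemma defect_pos: "cmod z < 1 \<Longrightarrow> 0 < defect z"
  by (simp add: defect_def power_less_one_iff abs_square_less_1)

lemma defect_square: "cmod z < 1 \<Longrightarrow> (complex_of_real (defect z))\<^sup>2 = 1 - z * cnj z"
  by (simp add: defect_def power_le_one complex_norm_square flip: of_real_power)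

text \<open>The formula for \<open>basis_poly\<close>, solved for its leading monomial; the defect
  is nonzero in the open disk. Recursion on the last letter then expresses monomials through basis
  polynomials.\<close>

lemma mono_word_snoc:
  assumes "cmod (t k) < 1"
  shows "mono_word (w @ [k]) =
    const (complex_of_real (defect (t k))) * basis_poly t (w @ [k]) + const (t k) * mono_word w"
proof -
  have "const (complex_of_real (defect (t k))) * basis_poly t (w @ [k]) =
    const (complex_of_real (defect (t k)) * complex_of_real (1 / defect (t k))) *
      (mono_word (w @ [k]) - const (t k) * mono_word w)"
    by (simp only: basis_poly_snoc const_mult mult.assoc)
  also have "complex_of_real (defect (t k)) * complex_of_real (1 / defect (t k)) = 1"
    using defect_pos[OF assms] by simp
  finally show ?thesis by simp
qed

lemma word_induct [consumes 1, case_names Nil snoc]: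
  assumes "w \<in> words N" "P []"
    "\<And>w k. w \<in> words N \<Longrightarrow> k \<in> {1..N} \<Longrightarrow> P w \<Longrightarrow> P (w @ [k])"
  shows "P w"
  using assms(1)
proof (induction w rule: rev_induct)
  case (snoc k w)
  then show ?case using assms(3) by (auto simp: words_append words_singleton)
qed (rule assms(2))

section \<open>Triangularity and spanning\<close>

lemma word_le_snoc: "w \<preceq> w @ [k]"
  by (simp add: word_le_def lenlex_conv)

lemma finite_word_less: "finite {\<beta>\<in>words N. \<beta> \<preceq> \<alpha> \<and> \<beta> \<noteq> \<alpha>}"
  by (rule finite_subset[OF _ finite_word_le[of N \<alpha>]]) auto

lemma basis_poly_triangular:
  assumes "\<alpha> \<in> words N" "\<forall>k\<in>{1..N}. cmod (t k) < 1"
  shows "\<exists>a. 0 < a \<alpha> \<and>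
    basis_poly t \<alpha> = (\<Sum>\<beta>\<in>{\<beta>\<in>words N. \<beta> \<preceq> \<alpha>}. const (a \<beta>) * mono_word \<beta>)"
proof (cases \<alpha> rule: rev_cases)
  case Nil
  have "{\<beta>\<in>words N. \<beta> \<preceq> []} = {[]}"
    by (auto simp: word_le_def words_Nil)
  with Nil show ?thesis
    by (intro exI[of _ "\<lambda>_. 1"]) (simp add: less_complex_def)
next
  case (snoc \<sigma> k)
  then have w: "\<sigma> \<in> words N" "k \<in> {1..N}"
    using assms by (simp_all add: words_append words_singleton)
  define d where "d = complex_of_real (1 / defect (t k))"
  have expand: "basis_poly t \<alpha> = const d * (mono_word (\<sigma> @ [k]) - const (t k) * mono_word \<sigma>)"
    by (simp only: snoc basis_poly_snoc d_def)
  \<comment> \<open>The two coefficients of \<open>expand\<close>, padded by zeros; both words lie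
    in \<open>?A\<close> because \<open>\<sigma>\<close> is shorter than
    \<open>\<alpha>\<close>.\<close>
  let ?a = "\<lambda>\<beta>. if \<beta> = \<sigma> @ [k] then d else if \<beta> = \<sigma> then - d * t k else 0"
  let ?A = "{\<beta>\<in>words N. \<beta> \<preceq> \<alpha>}"
  have "(\<Sum>\<beta>\<in>?A. const (?a \<beta>) * mono_word \<beta>) = (\<Sum>\<beta>\<in>{\<sigma> @ [k], \<sigma>}. const (?a \<beta>) * mono_word \<beta>)"
    using w assms(1) snoc word_le_snoc[of \<sigma> k]
    by (intro sum.mono_neutral_right finite_word_le) (auto simp: word_le_def)
  also have "\<dots> = basis_poly t \<alpha>"
    by (simp add: expand right_diff_distrib const_mult const_uminus mult.assoc)
  finally have "basis_poly t \<alpha> = (\<Sum>\<beta>\<in>?A. const (?a \<beta>) * mono_word \<beta>)" ..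
  moreover have "0 < ?a \<alpha>"
    using defect_pos[of "t k"] assms(2) w(2) snoc by (simp add: d_def less_complex_def)
  ultimately show ?thesis by (intro exI[of _ ?a]) simp
qed

text \<open>The linear map that sends each monomial to its basis polynomial. The finitely supported
  coefficient family is itself stored as an \<open>ncpoly\<close>, so that its sums and multiples
  are already available.\<close>

definition basis_expansion :: "(nat \<Rightarrow> complex) \<Rightarrow> ncpoly \<Rightarrow> ncpoly" where
  "basis_expansion t C =
    (\<Sum>\<alpha>\<in>Poly_Mapping.keys C. const (Poly_Mapping.lookup C \<alpha>) * basis_poly t \<alpha>)"

lemma basis_expansion_eq_sum:
  assumes "finite A" "Poly_Mapping.keys C \<subseteq> A"
  shows "basis_expansion t C = (\<Sum>\<alpha>\<in>A. const (Poly_Mapping.lookup C \<alpha>) * basis_poly t \<alpha>)"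
  unfolding basis_expansion_def
  using assms by (intro sum.mono_neutral_left) (auto simp: in_keys_iff)

lemma basis_expansion_add:
  "basis_expansion t (C + D) = basis_expansion t C + basis_expansion t D"
proof -
  let ?A = "Poly_Mapping.keys C \<union> Poly_Mapping.keys D"
  have "finite ?A" "Poly_Mapping.keys (C + D) \<subseteq> ?A"
    using Poly_Mapping.keys_add[of C D] by auto
  then show ?thesis
    by (simp add: basis_expansion_eq_sum[of ?A] lookup_add const_add distrib_right sum.distrib)
qed

lemma basis_expansion_const_mult:
  "basis_expansion t (const c * C) = const c * basis_expansion t C"
proof -
  have "Poly_Mapping.keys (const c * C) \<subseteq> Poly_Mapping.keys C"
    by (auto simp: in_keys_iff lookup_const_mult)
  then show ?thesis
    by (simp add: basis_expansion_eq_sum[of "Poly_Mapping.keys C"] lookup_const_mult const_mult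
        sum_distrib_left mult.assoc)
qed

lemma basis_expansion_sum:
  "basis_expansion t (sum f A) = (\<Sum>i\<in>A. basis_expansion t (f i))"
proof (induction A rule: infinite_finite_induct)
  case (insert i A)
  then show ?case by (simp add: basis_expansion_add)
qed (simp_all add: basis_expansion_def)

lemma basis_expansion_mono_word: "basis_expansion t (mono_word w) = basis_poly t w"
  by (simp add: basis_expansion_def mono_word_single)

lemma mono_word_eq_basis_expansion:
  assumes "\<forall>k\<in>{1..N}. cmod (t k) < 1" "w \<in> words N"
  shows "\<exists>C\<in>polys N. mono_word w = basis_expansion t C"
  using assms(2)
proof (induction w rule: word_induct)
  case Nil
  show ?case
    by (rule bexI[of _ "mono_word []"])
      (simp_all add: basis_expansion_mono_word words_Nil mono_word_in_polys del: mono_word_Nil,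
        simp)
next
  case (snoc w k)
  then obtain C where C: "C \<in> polys N" "mono_word w = basis_expansion t C"
    by blast
  \<comment> \<open>The right-hand side of \<open>mono_word_snoc\<close>, written in coefficients:
    the defect at \<open>w @ [k]\<close>, plus \<open>t k\<close> times the coefficients of
    \<open>mono_word w\<close>.\<close>
  let ?D = "const (complex_of_real (defect (t k))) * mono_word (w @ [k]) + const (t k) * C"
  have "basis_expansion t ?D = const (complex_of_real (defect (t k))) * basis_poly t (w @ [k]) +
      const (t k) * mono_word w"
    by (simp add: C(2) basis_expansion_add basis_expansion_const_mult basis_expansion_mono_word)
  then have "mono_word (w @ [k]) = basis_expansion t ?D"
    using mono_word_snoc[of t k w] assms(1) snoc.hyps by simp
  moreover have "?D \<in> polys N"
    using snoc.hyps C(1)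
    by (intro polys_add polys_const_mult mono_word_in_polys) (simp_all add: words_append words_singleton)
  ultimately show ?case by blast
qed

lemma polys_eq_basis_expansion:
  assumes "\<forall>k\<in>{1..N}. cmod (t k) < 1" "P \<in> polys N"
  shows "\<exists>C\<in>polys N. P = basis_expansion t C"
proof -
  obtain C where C: "\<And>w. w \<in> words N \<Longrightarrow> C w \<in> polys N \<and> mono_word w = basis_expansion t (C w)"
    using mono_word_eq_basis_expansion[OF assms(1)] by metis
  let ?K = "Poly_Mapping.keys P"
  let ?D = "\<Sum>w\<in>?K. const (Poly_Mapping.lookup P w) * C w"
  have K: "?K \<subseteq> words N"
    using assms(2) by (simp add: polys_def)
  have "basis_expansion t ?D = (\<Sum>w\<in>?K. const (Poly_Mapping.lookup P w) * mono_word w)"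
    using C K by (simp add: basis_expansion_sum basis_expansion_const_mult subset_iff)
  then have "P = basis_expansion t ?D"
    using poly_eq_sum_mono[OF finite_keys subset_refl, of P] by simp
  moreover have "?D \<in> polys N"
    using C K by (auto intro!: polys_sum polys_const_mult)
  ultimately show ?thesis by blast
qed

section \<open>The sesquilinear form of the functional\<close>

locale moment_functional =
  fixes N :: nat and t :: "nat \<Rightarrow> complex" and \<phi> :: "ncpoly \<Rightarrow> complex"
  assumes t_disk: "\<forall>k\<in>{1..N}. cmod (t k) < 1"
    and linear: "linear_functional_on (polys (2 * N)) \<phi>"
    and moments: "\<forall>w\<in>words (2 * N). \<phi> (mono_word w) = t_word t (eps_word N w)"
begin

text \<open>Conjugate-linear in the first argument. The rules below ask for arguments in
  \<open>polys N\<close>, which puts the product in \<open>polys (2 * N)\<close>, where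
  \<open>\<phi>\<close> is linear.\<close>

definition form :: "ncpoly \<Rightarrow> ncpoly \<Rightarrow> complex" where
  "form P Q = \<phi> (adj N P * Q)"

lemma adj_mult_in_polys: "P \<in> polys N \<Longrightarrow> Q \<in> polys N \<Longrightarrow> adj N P * Q \<in> polys (2 * N)"
  using polys_mono[of N "2 * N"] by (intro polys_mult adj_in_polys) auto

lemma form_add_left:
  "P \<in> polys N \<Longrightarrow> P' \<in> polys N \<Longrightarrow> Q \<in> polys N \<Longrightarrow> form (P + P') Q = form P Q + form P' Q"
  using linear unfolding linear_functional_on_def form_def
  by (simp add: adj_add distrib_right adj_mult_in_polys)

lemma form_add_right:
  "P \<in> polys N \<Longrightarrow> Q \<in> polys N \<Longrightarrow> Q' \<in> polys N \<Longrightarrow> form P (Q + Q') = form P Q + form P Q'"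
  using linear unfolding linear_functional_on_def form_def
  by (simp add: distrib_left adj_mult_in_polys)

lemma form_const_left:
  "P \<in> polys N \<Longrightarrow> Q \<in> polys N \<Longrightarrow> form (const c * P) Q = cnj c * form P Q"
  using linear unfolding linear_functional_on_def form_def
  by (simp add: adj_const_mult mult.assoc adj_mult_in_polys)

lemma form_const_right:
  assumes "P \<in> polys N" "Q \<in> polys N"
  shows "form P (const c * Q) = c * form P Q"
  using linear assms unfolding linear_functional_on_def form_def
  by (simp add: const_left_commute adj_mult_in_polys)

lemma form_diff_left:
  assumes "P \<in> polys N" "P' \<in> polys N" "Q \<in> polys N"
  shows "form (P - P') Q = form P Q - form P' Q"
  using form_add_left[of "P - P'" P' Q] assms by (simp add: polys_diff)

lemma form_diff_right:
  assumes "P \<in> polys N" "Q \<in> polys N" "Q' \<in> polys N"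
  shows "form P (Q - Q') = form P Q - form P Q'"
  using form_add_right[of P "Q - Q'" Q'] assms by (simp add: polys_diff)

lemma form_zero_left: "Q \<in> polys N \<Longrightarrow> form 0 Q = 0"
  using form_const_left[of 0 Q 0] by (simp add: polys_zero)

lemma form_zero_right: "P \<in> polys N \<Longrightarrow> form P 0 = 0"
  using form_const_right[of P 0 0] by (simp add: polys_zero)

lemma form_sum_left:
  assumes "\<And>i. i \<in> A \<Longrightarrow> f i \<in> polys N" "Q \<in> polys N"
  shows "form (\<Sum>i\<in>A. const (c i) * f i) Q = (\<Sum>i\<in>A. cnj (c i) * form (f i) Q)"
  using assms
  by (induction A rule: infinite_finite_induct)
    (simp_all add: form_zero_left form_add_left form_const_left polys_const_mult polys_sum)

lemma form_sum_right:
  assumes "\<And>i. i \<in> A \<Longrightarrow> f i \<in> polys N" "P \<in> polys N"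
  shows "form P (\<Sum>i\<in>A. const (c i) * f i) = (\<Sum>i\<in>A. c i * form P (f i))"
  using assms
  by (induction A rule: infinite_finite_induct)
    (simp_all add: form_zero_right form_add_right form_const_right polys_const_mult polys_sum)

section \<open>Gram matrix and orthonormality\<close>

lemma form_mono_word:
  assumes "u \<in> words N" "v \<in> words N"
  shows "form (mono_word u) (mono_word v) = kernel t u v"
proof -
  have "adj_word N u @ v \<in> words (2 * N)"
    using assms words_mono[of N "2 * N"] by (auto simp: words_append adj_word_in_words)
  then show ?thesis
    using moments assms
    by (simp add: form_def adj_mono_word t_word_adj_append flip: mono_word_append)
qed

lemma form_mono_word_basis_poly:
  assumes "u \<in> words N" "v @ [k] \<in> words N"
  shows "form (mono_word u) (basis_poly t (v @ [k])) =
    complex_of_real (1 / defect (t k)) * (kernel t u (v @ [k]) - t k * kernel t u v)"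
  using assms
  by (simp add: basis_poly_snoc form_const_right form_diff_right form_mono_word polys_const_mult
      polys_diff mono_word_in_polys words_append)

lemma form_basis_poly_mono_word:
  assumes "u \<in> words N" "v @ [k] \<in> words N"
  shows "form (basis_poly t (v @ [k])) (mono_word u) =
    complex_of_real (1 / defect (t k)) * (kernel t (v @ [k]) u - cnj (t k) * kernel t v u)"
  using assms
  by (simp add: basis_poly_snoc form_const_left form_diff_left form_mono_word polys_const_mult
      polys_diff mono_word_in_polys words_append)

text \<open>By \<open>kernel_snoc\<close> the two terms of the basis polynomial contribute equal
  amounts, which cancel.\<close>

lemma form_mono_word_basis_poly_eq_0:
  assumes "u \<in> words N" "v \<in> words N" "v \<noteq> []" "\<not> prefix v u"
  shows "form (mono_word u) (basis_poly t v) = 0"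
  using assms(3)
proof (cases v rule: rev_cases)
  case (snoc w k)
  then show ?thesis
    using assms by (simp add: form_mono_word_basis_poly kernel_snoc)
qed simp

lemma form_basis_poly_mono_word_eq_0:
  assumes "u \<in> words N" "v \<in> words N" "v \<noteq> []" "\<not> prefix v u"
  shows "form (basis_poly t v) (mono_word u) = 0"
  using assms(3)
proof (cases v rule: rev_cases)
  case (snoc w k)
  then have "kernel t v u = cnj (t k) * kernel t w u"
    using assms(4) by (simp add: kernel_cnj[of t _ u] kernel_snoc)
  then show ?thesis
    using assms snoc by (simp add: form_basis_poly_mono_word)
qed simp

text \<open>Expands one factor only: \<open>P\<close> stays arbitrary and may itself be a basis
  polynomial.\<close>

lemma form_basis_poly_snoc_right:
  assumes "P \<in> polys N" "v @ [k] \<in> words N"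
  shows "form P (basis_poly t (v @ [k])) = complex_of_real (1 / defect (t k)) *
    (form P (mono_word (v @ [k])) - t k * form P (mono_word v))"
  using assms
  by (simp add: basis_poly_snoc form_const_right form_diff_right polys_const_mult
      polys_diff mono_word_in_polys words_append)

lemma form_basis_poly_snoc_left:
  assumes "P \<in> polys N" "v @ [k] \<in> words N"
  shows "form (basis_poly t (v @ [k])) P = complex_of_real (1 / defect (t k)) *
    (form (mono_word (v @ [k])) P - cnj (t k) * form (mono_word v) P)"
  using assms
  by (simp add: basis_poly_snoc form_const_left form_diff_left polys_const_mult
      polys_diff mono_word_in_polys words_append)

text \<open>Off the diagonal, the basis polynomial of a word that is not a prefix of the other is
  kept, and the other one is expanded into monomials orthogonal to it.\<close>

lemma form_basis_poly:
  assumes u: "u \<in> words N" and v: "v \<in> words N"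
  shows "form (basis_poly t u) (basis_poly t v) = (if v = u then 1 else 0)"
proof (cases "v = u")
  case True
  show ?thesis
  proof (cases v rule: rev_cases)
    case Nil
    then show ?thesis using True form_mono_word[OF words_Nil words_Nil] by (simp add: t_prod_def)
  next
    case (snoc w k)
    then have "k \<in> {1..N}" "w \<in> words N"
      using v by (simp_all add: words_append words_singleton)
    \<comment> \<open>Only the leading monomial on the right contributes: the form with
      \<open>mono_word w\<close> vanishes, as \<open>kernel t (w @ [k]) w\<close> is
      \<open>cnj (t k)\<close>.\<close>
    then have "form (basis_poly t v) (basis_poly t v) =
        (complex_of_real (1 / defect (t k)))\<^sup>2 * (1 - t k * cnj (t k))"
      using v snoc kernel_cnj[of t "w @ [k]" w]
      by (simp add: form_basis_poly_snoc_right form_basis_poly_mono_word basis_poly_in_polys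
          kernel_refl kernel_snoc_self power2_eq_square)
    also have "\<dots> = 1"
      using defect_square[of "t k"] defect_pos[of "t k"] t_disk \<open>k \<in> {1..N}\<close>
      by (simp add: power_one_over field_simps)
    finally show ?thesis using True by simp
  qed
next
  case False
  show ?thesis
  proof (cases "v \<noteq> [] \<and> \<not> prefix v u")
    case True
    show ?thesis
    proof (cases u rule: rev_cases)
      case Nil
      then show ?thesis
        using True v form_mono_word_basis_poly_eq_0[OF words_Nil v] by simp
    next
      case (snoc w k)
      \<comment> \<open>A prefix of \<open>w\<close> is a prefix of \<open>u\<close>, so both
        monomials of \<open>basis_poly t u\<close> are orthogonal to
        \<open>basis_poly t v\<close>.\<close>
      then have "\<not> prefix v w" "w \<in> words N"
        using True u by (auto simp: words_append)
      then show ?thesis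
        using True False u v snoc form_mono_word_basis_poly_eq_0[of _ v]
        by (simp add: form_basis_poly_snoc_left basis_poly_in_polys)
    qed
  next
    case v_prefix: False
    \<comment> \<open>Here \<open>v\<close> is a prefix of \<open>u\<close>, possibly empty, and
      differs from it; by antisymmetry the roles are exchanged.\<close>
    then have u_prefix: "u \<noteq> []" "\<not> prefix u v"
      using False by (auto dest: prefix_order.antisym)
    show ?thesis
    proof (cases v rule: rev_cases)
      case Nil
      then show ?thesis
        using u_prefix u form_basis_poly_mono_word_eq_0[OF words_Nil u] by simp
    next
      case (snoc w k)
      then have "\<not> prefix u w" "w \<in> words N"
        using u_prefix v by (auto simp: words_append)
      then show ?thesis
        using u_prefix False u v snoc form_basis_poly_mono_word_eq_0[of _ u]
        by (simp add: form_basis_poly_snoc_right basis_poly_in_polys)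
    qed
  qed
qed

section \<open>Positivity and uniqueness\<close>

lemma form_basis_expansion:
  assumes "C \<in> polys N"
  shows "form (basis_expansion t C) (basis_expansion t C) =
    complex_of_real (\<Sum>\<alpha>\<in>Poly_Mapping.keys C. (cmod (Poly_Mapping.lookup C \<alpha>))\<^sup>2)"
proof -
  let ?K = "Poly_Mapping.keys C" and ?c = "Poly_Mapping.lookup C"
  have K: "\<alpha> \<in> words N" if "\<alpha> \<in> ?K" for \<alpha>
    using that assms by (auto simp: polys_def)
  have E: "basis_expansion t C \<in> polys N"
    using K by (auto simp: basis_expansion_def intro!: polys_sum polys_const_mult basis_poly_in_polys)
  \<comment> \<open>Orthonormality extracts the coefficient at \<open>\<alpha>\<close>; expanding
    the left argument as well gives Parseval's identity.\<close>
  have "form (basis_poly t \<alpha>) (basis_expansion t C) = ?c \<alpha>" if "\<alpha> \<in> ?K" for \<alpha>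
    using that K unfolding basis_expansion_def
    by (simp add: form_sum_right form_basis_poly basis_poly_in_polys sum.delta if_distrib cong: if_cong)
  then have "form (basis_expansion t C) (basis_expansion t C) = (\<Sum>\<alpha>\<in>?K. cnj (?c \<alpha>) * ?c \<alpha>)"
    using K E by (subst (1) basis_expansion_def) (simp add: form_sum_left basis_poly_in_polys)
  then show ?thesis
    by (simp only: of_real_sum complex_norm_square mult.commute)
qed

text \<open>By spanning and Parseval the value is a sum of positive squares over the support of
  \<open>C\<close>, which is nonempty because the zero family expands to 0.\<close>

lemma form_pos:
  assumes "P \<in> polys N" "P \<noteq> 0"
  shows "0 < form P P"
proof -
  obtain C where C: "C \<in> polys N" "P = basis_expansion t C"
    using polys_eq_basis_expansion[OF t_disk assms(1)] by blast
  then have "C \<noteq> 0"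
    using assms(2) by (auto simp: basis_expansion_def)
  then have "0 < (\<Sum>\<alpha>\<in>Poly_Mapping.keys C. (cmod (Poly_Mapping.lookup C \<alpha>))\<^sup>2)"
    by (intro sum_pos) (auto simp: in_keys_iff)
  then show ?thesis
    using form_basis_expansion[OF C(1)] C(2) by (simp add: less_complex_def)
qed

text \<open>Well-founded induction along the word order. After subtraction of a multiple of the
  basis polynomial, the remainder lies in the span of the smaller monomials and is orthogonal to it,
  hence is 0 by positivity.\<close>

lemma orthonormal_imp_basis_poly:
  assumes "orthonormal_polynomials N \<phi> p" "\<alpha> \<in> words N"
  shows "p \<alpha> = basis_poly t \<alpha>"
  using wf_lenlex[OF wf_less_than] assms(2)
proof (induction \<alpha> rule: wf_induct_rule)
  case (less \<alpha>)
  let ?q = "basis_poly t" and ?B = "{\<beta>\<in>words N. \<beta> \<preceq> \<alpha> \<and> \<beta> \<noteq> \<alpha>}"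
  have split: "{\<beta>\<in>words N. \<beta> \<preceq> \<alpha>} = insert \<alpha> ?B"
    using less.prems by (auto simp: word_le_def)
  obtain a where a: "0 < a \<alpha>"
      "p \<alpha> = (\<Sum>\<beta>\<in>{\<beta>\<in>words N. \<beta> \<preceq> \<alpha>}. const (a \<beta>) * mono_word \<beta>)"
    using assms(1) less.prems unfolding orthonormal_polynomials_def by blast
  obtain b where b: "0 < b \<alpha>"
      "?q \<alpha> = (\<Sum>\<beta>\<in>{\<beta>\<in>words N. \<beta> \<preceq> \<alpha>}. const (b \<beta>) * mono_word \<beta>)"
    using basis_poly_triangular[OF less.prems t_disk] by blast
  \<comment> \<open>The quotient of the leading coefficients, so that \<open>\<alpha>\<close> drops
    out of \<open>R\<close>.\<close>
  define c where "c = a \<alpha> / b \<alpha>"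
  define R where "R = p \<alpha> - const c * ?q \<alpha>"
  have pq: "p \<alpha> \<in> polys N" "?q \<alpha> \<in> polys N"
    using less.prems by (auto simp: a(2) intro!: polys_sum polys_const_mult mono_word_in_polys basis_poly_in_polys)
  then have R_poly: "R \<in> polys N"
    by (simp add: R_def polys_diff polys_const_mult)
  have "R = (\<Sum>\<beta>\<in>insert \<alpha> ?B. const (a \<beta> - c * b \<beta>) * mono_word \<beta>)"
    by (simp only: R_def a(2) b(2) split sum_distrib_left sum_subtractf[symmetric] const_diff
        const_mult left_diff_distrib mult.assoc)
  moreover have "a \<alpha> - c * b \<alpha> = 0"
    using b(1) by (auto simp: c_def)
  ultimately have R_sum: "R = (\<Sum>\<beta>\<in>?B. const (a \<beta> - c * b \<beta>) * mono_word \<beta>)"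
    using finite_word_less by simp
  \<comment> \<open>By the induction hypothesis \<open>p \<beta>\<close> is the basis polynomial, so
    both terms of \<open>R\<close> are orthogonal to it.\<close>
  have q_orth: "form (?q \<beta>) R = 0" if "\<beta> \<in> ?B" for \<beta>
  proof -
    have "p \<beta> = ?q \<beta>"
      using that less.IH by (auto simp: word_le_def)
    then have "form (?q \<beta>) (p \<alpha>) = 0"
      using assms(1) that less.prems unfolding orthonormal_polynomials_def form_def by force
    moreover have "form (?q \<beta>) (?q \<alpha>) = 0"
      using that less.prems form_basis_poly[of \<beta> \<alpha>] by auto
    ultimately show ?thesis
      using that pq
      by (simp add: R_def form_diff_right form_const_right basis_poly_in_polys polys_const_mult)
  qed
  \<comment> \<open>Orthogonality passes from basis polynomials to monomials by
    \<open>mono_word_snoc\<close>; \<open>w\<close> precedes \<open>w @ [k]\<close> and thus stays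
    below \<open>\<alpha>\<close>.\<close>
  have "\<beta> \<preceq> \<alpha> \<and> \<beta> \<noteq> \<alpha> \<longrightarrow> form (mono_word \<beta>) R = 0" if "\<beta> \<in> words N" for \<beta>
    using that
  proof (induction \<beta> rule: word_induct)
    case Nil
    show ?case using q_orth[of "[]"] by (simp add: words_Nil)
  next
    case (snoc w k)
    show ?case
    proof
      assume wk: "w @ [k] \<preceq> \<alpha> \<and> w @ [k] \<noteq> \<alpha>"
      have wk_word: "w @ [k] \<in> words N"
        using snoc.hyps by (simp add: words_append words_singleton)
      have "(w, \<alpha>) \<in> lenlex less_than"
        using word_le_snoc[of w k] wk lenlex_transI[OF trans_less_than]
        by (auto simp: word_le_def dest: transD)
      then have "w \<preceq> \<alpha> \<and> w \<noteq> \<alpha>"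
        using wf_lenlex[OF wf_less_than] by (auto simp: word_le_def)
      with snoc.IH have "form (mono_word w) R = 0" by simp
      moreover have "form (?q (w @ [k])) R = 0"
        using q_orth wk wk_word by simp
      ultimately show "form (mono_word (w @ [k])) R = 0"
        using mono_word_snoc[of t k w] t_disk snoc.hyps wk_word R_poly
        by (simp add: form_add_left form_const_left polys_const_mult
            basis_poly_in_polys mono_word_in_polys)
    qed
  qed
  then have mono_orth: "form (mono_word \<beta>) R = 0" if "\<beta> \<in> ?B" for \<beta>
    using that by blast
  have "form R R = (\<Sum>\<beta>\<in>?B. cnj (a \<beta> - c * b \<beta>) * form (mono_word \<beta>) R)"
    using R_poly by (subst (1) R_sum, intro form_sum_left) (auto intro: mono_word_in_polys)
  also have "\<dots> = 0"
    using mono_orth by (intro sum.neutral ballI) simp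
  finally have "form R R = 0" .
  then have "R = 0"
    using form_pos[OF R_poly] by auto
  then have p_eq: "p \<alpha> = const c * ?q \<alpha>"
    by (simp add: R_def)
  \<comment> \<open>Normalization leaves a factor of modulus 1, and positive leading coefficients
    make it 1.\<close>
  have "1 = form (p \<alpha>) (p \<alpha>)"
    using assms(1) less.prems by (simp add: orthonormal_polynomials_def form_def)
  also have "\<dots> = c * cnj c"
    using pq less.prems
    by (simp add: p_eq form_const_left form_const_right form_basis_poly polys_const_mult)
  finally have "complex_of_real ((cmod c)\<^sup>2) = 1"
    by (simp only: complex_norm_square)
  then have "cmod c = 1"
    unfolding of_real_eq_1_iff by (simp add: power2_eq_1_iff) (smt (verit) norm_ge_zero)
  moreover have "0 < c"
    using a(1) b(1) by (auto simp: c_def less_complex_def complex_eq_iff Re_divide Im_divide field_simps)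
  ultimately have "c = 1"
    by (auto simp: less_complex_def complex_eq_iff cmod_def power2_eq_1_iff)
  then show ?case
    by (simp add: p_eq)
qed

lemma orthonormal_polynomials_iff:
  "orthonormal_polynomials N \<phi> p \<longleftrightarrow> (\<forall>\<alpha>\<in>words N. p \<alpha> = basis_poly t \<alpha>)"
proof
  assume "\<forall>\<alpha>\<in>words N. p \<alpha> = basis_poly t \<alpha>"
  then show "orthonormal_polynomials N \<phi> p"
    using basis_poly_triangular[OF _ t_disk] form_basis_poly
    by (simp add: orthonormal_polynomials_def form_def)
qed (simp add: orthonormal_imp_basis_poly)

end

theorem theorem3p1:
  fixes N :: nat and t :: "nat \<Rightarrow> complex" and \<phi> :: "ncpoly \<Rightarrow> complex"
  assumes "N \<ge> 1"
    and "\<forall>k\<in>{1..N}. cmod (t k) < 1"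
    and "linear_functional_on (polys (2 * N)) \<phi>"
    and "\<forall>w\<in>words (2 * N). \<phi> (mono_word w) = t_word t (eps_word N w)"
  shows "strictly_q_positive N \<phi> \<and>
    (\<forall>p. orthonormal_polynomials N \<phi> p \<longleftrightarrow>
      p [] = 1 \<and>
      (\<forall>k\<in>{1..N}. p [k] = const (complex_of_real (1 / defect (t k))) * (var k - const (t k))) \<and>
      (\<forall>\<sigma>\<in>words N. \<forall>k\<in>{1..N}. p (\<sigma> @ [k]) = mono_word \<sigma> * p [k]))"
proof -
  interpret moment_functional N t \<phi>
    using assms(2-4) by unfold_locales
  have "strictly_q_positive N \<phi>"
    using form_pos by (simp add: strictly_q_positive_def form_def)
  \<comment> \<open>Every nonempty word has a last letter, so the clauses determine \<open>p\<close>
    on \<open>words N\<close>. For empty \<open>\<sigma>\<close> the product clause is trivially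
    consistent with the value at \<open>[k]\<close>.\<close>
  moreover have "(\<forall>\<alpha>\<in>words N. p \<alpha> = basis_poly t \<alpha>) \<longleftrightarrow>
      p [] = 1 \<and> (\<forall>k\<in>{1..N}. p [k] = basis_poly t [k]) \<and>
      (\<forall>\<sigma>\<in>words N. \<forall>k\<in>{1..N}. p (\<sigma> @ [k]) = mono_word \<sigma> * p [k])" (is "?L \<longleftrightarrow> ?R") for p
  proof
    assume ?L
    then show ?R
      by (simp add: words_Nil words_append words_singleton flip: basis_poly_snoc_eq_mult)
  next
    assume R: ?R
    show ?L
    proof
      fix \<alpha> assume "\<alpha> \<in> words N"
      then show "p \<alpha> = basis_poly t \<alpha>"
        using R basis_poly_snoc_eq_mult by (induction \<alpha> rule: word_induct) simp_all
    qed
  qed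
  ultimately show ?thesis
    by (simp only: orthonormal_polynomials_iff basis_poly_singleton) simp
qed

end
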